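(* Let $f(x)=f_{-1}+f_0x+\ldots+f_dx^{d+1}$ be the extended $f$-polynomial of a finite simplicial complex of dimension $d$, and let $h(x)=h_0+h_1x+\ldots+h_{d+1}x^{d+1}=(1-x)^{d+1}f\left(\frac{x}{1-x}\right)$ be its $h$-polynomial. Then the Dehn--Sommerville equations $$h_k=h_{d+1-k},\qquad k=0,\ldots,d+1,$$ hold if and only if the following equations hold: $$\sum_{j=k}^d(-1)^j\binom{j+1}{k+1}f_j=(-1)^df_k,\qquad k=-1,\ldots,d.$$
   Context: The extended $f$-polynomial of a finite simplicial complex of dimension $d$ is $f(x)=f_{-1}+f_0x+\ldots+f_dx^{d+1}$, where $f_i$ is the number of $i$-dimensional faces and $f_{-1}=1$ (counting the empty face). *)

theory Defs
  imports "HOL-Analysis.Analysis" "HOL-Computational_Algebra.Polynomial"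
begin

text \<open>
  A simplicial complex in the sense of \<^const>\<open>simplicial_complex\<close> that has at least one member
  contains the empty set, the unique \<open>-1\<close>-simplex. Dimensions are integers \<open>\<ge> -1\<close>.
\<close>

definition f_num :: "'a::euclidean_space set set \<Rightarrow> int \<Rightarrow> nat" where
  "f_num C i = card {S \<in> C. i simplex S}"

definition complex_dim :: "'a::euclidean_space set set \<Rightarrow> int" where
  "complex_dim C = Max (aff_dim ` C)"

text \<open>The coefficient of \<open>x ^ i\<close> is the number of faces of dimension \<open>i - 1\<close>.\<close>

definition f_poly :: "'a::euclidean_space set set \<Rightarrow> real poly" where
  "f_poly C = (\<Sum>i\<le>nat (complex_dim C + 1). monom (real (f_num C (int i - 1))) i)"

text \<open>
  The identity \<open>h(x) = (1 - x)^(d + 1) f(x / (1 - x))\<close> of rational functions, read as an identity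
  of real functions away from the pole \<open>x = 1\<close>, determines the polynomial \<open>h\<close>.
\<close>

definition is_h_poly :: "'a::euclidean_space set set \<Rightarrow> real poly \<Rightarrow> bool" where
  "is_h_poly C h \<longleftrightarrow>
    (\<forall>x. x \<noteq> 1 \<longrightarrow> poly h x = (1 - x) ^ nat (complex_dim C + 1) * poly (f_poly C) (x / (1 - x)))"

definition h_poly :: "'a::euclidean_space set set \<Rightarrow> real poly" where
  "h_poly C = (THE h. is_h_poly C h)"

lemma ex1_h_poly: "\<exists>!h. is_h_poly C h"
proof (rule ex_ex1I)
  define n where "n = nat (complex_dim C + 1)"
  define a where "a i = real (f_num C (int i - 1))" for i :: nat
  define h where "h = (\<Sum>i\<le>n. monom (a i) i * [:1, -1:] ^ (n - i))"
  have "poly h x = (1 - x) ^ n * poly (f_poly C) (x / (1 - x))" if "x \<noteq> 1" for x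
  proof -
    have "(1 - x) ^ n * poly (f_poly C) (x / (1 - x))
        = (\<Sum>i\<le>n. (1 - x) ^ n * (a i * (x / (1 - x)) ^ i))"
      by (simp add: f_poly_def n_def a_def poly_sum poly_monom sum_distrib_left)
    also have "\<dots> = (\<Sum>i\<le>n. a i * x ^ i * (1 - x) ^ (n - i))"
    proof (rule sum.cong)
      fix i assume "i \<in> {..n}"
      then show "(1 - x) ^ n * (a i * (x / (1 - x)) ^ i) = a i * x ^ i * (1 - x) ^ (n - i)"
        using that by (simp add: power_diff power_divide)
    qed simp
    also have "\<dots> = poly h x"
      by (simp add: h_def poly_sum poly_monom)
    finally show ?thesis by simp
  qed
  then show "\<exists>h. is_h_poly C h"
    unfolding is_h_poly_def n_def by blast
next
  fix g h assume "is_h_poly C g" "is_h_poly C h"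
  then have "- {1} \<subseteq> {x. poly (g - h) x = 0}"
    by (auto simp: is_h_poly_def)
  moreover have "infinite (- {1 :: real})"
    by (simp add: Compl_eq_Diff_UNIV infinite_UNIV_char_0)
  ultimately show "g = h"
    using poly_roots_finite[of "g - h"] infinite_super by fastforce
qed

lemma h_poly_eq:
  assumes "x \<noteq> 1"
  shows "poly (h_poly C) x = (1 - x) ^ nat (complex_dim C + 1) * poly (f_poly C) (x / (1 - x))"
  using theI'[OF ex1_h_poly[of C]] assms by (auto simp: h_poly_def is_h_poly_def)

end

theory Submission
  imports Defs
begin

text \<open>
  With \<open>n = d + 1\<close> and \<open>y = x / (1 - x)\<close> one has \<open>h(x) = (1 - x)^n f(y)\<close>, and since
  \<open>(1/x) / (1 - 1/x) = -1 - y\<close> also \<open>x^n h(1/x) = (x - 1)^n f(-1 - y)\<close>. Hence \<open>h\<close> is palindromic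
  iff \<open>f(-1 - y) = (-1)^n f(y)\<close>, and the second family of equations is this functional equation
  written out in coefficients.
\<close>

text \<open>A nonzero polynomial has finitely many roots, while the complement of a finite set is
  infinite in characteristic 0. Identities between rational functions can thus be checked away from
  their poles.\<close>

lemma poly_eqI_cofinite:
  fixes p q :: "'a::{idom,ring_char_0} poly"
  assumes "finite A" "\<And>x. x \<notin> A \<Longrightarrow> poly p x = poly q x"
  shows "p = q"
proof -
  have "- A \<subseteq> {x. poly (p - q) x = 0}"
    using assms(2) by auto
  moreover have "infinite (- A)"
    using assms(1) by (simp add: Compl_eq_Diff_UNIV infinite_UNIV_char_0)
  ultimately show ?thesis
    using poly_roots_finite[of "p - q"] infinite_super by fastforce
qed

lemma poly_eq_sum_le:
  fixes p :: "'a::comm_semiring_1 poly"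
  assumes "degree p \<le> n"
  shows "poly p x = (\<Sum>i\<le>n. coeff p i * x ^ i)"
  unfolding poly_altdef using assms
  by (intro sum.mono_neutral_left) (auto simp: coeff_eq_0)

text \<open>Expand \<open>(-1 - y) ^ i = (-1) ^ i * (1 + y) ^ i\<close> by the binomial theorem; the
  terms with \<open>i < m\<close> vanish because \<open>i choose m = 0\<close>.\<close>

lemma coeff_pcompose_reflection:
  fixes p :: "'a::idom poly"
  assumes "degree p \<le> n"
  shows "coeff (pcompose p [:-1, -1:]) m =
    (\<Sum>i=m..n. (-1) ^ i * of_nat (i choose m) * coeff p i)"
proof -
  have "pcompose p [:-1, -1:] = (\<Sum>i\<le>n. smult (coeff p i) ([:-1, -1:] ^ i))"
    using assms by (simp add: pcompose_altdef poly_eq_sum_le[of _ n] degree_map_poly coeff_map_poly)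
  also have "coeff \<dots> m = (\<Sum>i\<le>n. (-1) ^ i * of_nat (i choose m) * coeff p i)"
    unfolding coeff_sum
  proof (rule sum.cong)
    fix i
    have "[:-1, -1::'a:] ^ i = smult ((-1) ^ i) ([:1, 1:] ^ i)"
      by (simp flip: smult_power)
    moreover have "coeff ([:1, 1::'a:] ^ i) m = of_nat (i choose m)"
      using coeff_linear_poly_power[of m i 1 "1::'a"]
      by (cases "m \<le> i") (auto intro!: coeff_eq_0 simp: degree_linear_power binomial_eq_0)
    ultimately show "coeff (smult (coeff p i) ([:-1, -1:] ^ i)) m =
        (-1) ^ i * of_nat (i choose m) * coeff p i"
      by simp
  qed simp
  also have "\<dots> = (\<Sum>i=m..n. (-1) ^ i * of_nat (i choose m) * coeff p i)"
    by (intro sum.mono_neutral_right) (auto simp: binomial_eq_0)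
  finally show ?thesis .
qed

text \<open>Comparison of coefficients. Those of index above \<open>n\<close> impose no condition,
  since both sides are then zero.\<close>

lemma pcompose_reflection_iff:
  fixes p :: "'a::idom poly"
  assumes "degree p \<le> n"
  shows "pcompose p [:-1, -1:] = smult ((-1) ^ n) p \<longleftrightarrow>
    (\<forall>m\<le>n. (\<Sum>i=m..n. (-1) ^ i * of_nat (i choose m) * coeff p i) = (-1) ^ n * coeff p m)"
proof -
  have "coeff p m = 0" if "\<not> m \<le> n" for m
    using assms that by (simp add: coeff_eq_0)
  then have "(\<Sum>i=m..n. (-1) ^ i * of_nat (i choose m) * coeff p i) = (-1) ^ n * coeff p m"
    if "\<not> m \<le> n" for m
    using that by simp
  then show ?thesis
    unfolding poly_eq_iff coeff_pcompose_reflection[OF assms] coeff_smult by blast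
qed

lemma palindromic_iff:
  fixes h :: "'a::field_char_0 poly"
  assumes "degree h \<le> n"
  shows "(\<forall>k\<le>n. coeff h k = coeff h (n - k)) \<longleftrightarrow>
    (\<forall>x. x \<notin> {0, 1} \<longrightarrow> x ^ n * poly h (1 / x) = poly h x)"
proof -
  \<comment> \<open>The reversal of \<open>h\<close> is taken relative to \<open>n\<close> and not
    to \<open>degree h\<close>, because the top coefficients of \<open>h\<close> may vanish.
    Palindromicity then reads \<open>r = h\<close>.\<close>
  define r where "r = (\<Sum>k\<le>n. monom (coeff h (n - k)) k)"
  have r: "coeff r k = (if k \<le> n then coeff h (n - k) else 0)" for k
    by (simp add: r_def coeff_sum)
  have poly_r: "poly r x = x ^ n * poly h (1 / x)" if "x \<noteq> 0" for x
  proof -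
    have "x ^ n * poly h (1 / x) = (\<Sum>i\<le>n. coeff h i * x ^ (n - i))"
      unfolding poly_eq_sum_le[OF assms] sum_distrib_left using that
      by (intro sum.cong) (auto simp: power_diff power_divide)
    also have "\<dots> = (\<Sum>i\<le>n. coeff h (n - i) * x ^ i)"
      by (rule sum.reindex_bij_witness[of _ "\<lambda>i. n - i" "\<lambda>i. n - i"]) auto
    finally show ?thesis
      by (simp add: r_def poly_sum poly_monom)
  qed
  have "(\<forall>k\<le>n. coeff h k = coeff h (n - k)) \<longleftrightarrow> r = h"
  proof -
    have "coeff h k = 0" if "\<not> k \<le> n" for k
      using assms that by (simp add: coeff_eq_0)
    then show ?thesis
      unfolding poly_eq_iff r by metis
  qed
  also have "\<dots> \<longleftrightarrow> (\<forall>x. x \<notin> {0, 1} \<longrightarrow> poly r x = poly h x)"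
    using poly_eqI_cofinite[of "{0, 1}" r h] by auto
  finally show ?thesis
    by (simp add: poly_r)
qed

lemma palindromic_iff_reflection:
  fixes f h :: "'a::field_char_0 poly"
  assumes "degree h \<le> n"
    and h: "\<And>x. x \<noteq> 1 \<Longrightarrow> poly h x = (1 - x) ^ n * poly f (x / (1 - x))"
  shows "(\<forall>k\<le>n. coeff h k = coeff h (n - k)) \<longleftrightarrow>
    pcompose f [:-1, -1:] = smult ((-1) ^ n) f"
proof -
  have *: "x ^ n * poly h (1 / x) = poly h x \<longleftrightarrow>
      poly f (-1 - x / (1 - x)) = (-1) ^ n * poly f (x / (1 - x))" if "x \<notin> {0, 1}" for x
  proof -
    \<comment> \<open>The first identity says that inverting \<open>x\<close> reflects
      \<open>x / (1 - x)\<close> about \<open>-1/2\<close>; the second lets \<open>x ^ n\<close>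
      absorb the denominators of \<open>(1 - 1 / x) ^ n\<close>.\<close>
    have "1 / x / (1 - 1 / x) = -1 - x / (1 - x)" "x * (1 - 1 / x) = - (1 - x)"
      using that by (auto simp: divide_simps)
    then have "x ^ n * poly h (1 / x) = (- (1 - x)) ^ n * poly f (-1 - x / (1 - x))"
      using that by (simp add: h flip: power_mult_distrib mult.assoc)
    also have "\<dots> = (1 - x) ^ n * ((-1) ^ n * poly f (-1 - x / (1 - x)))"
      by (subst power_minus) simp
    finally have "x ^ n * poly h (1 / x) = poly h x \<longleftrightarrow>
        (-1) ^ n * poly f (-1 - x / (1 - x)) = poly f (x / (1 - x))"
      using that by (simp add: h)
    \<comment> \<open>The factor \<open>(-1) ^ n\<close> is its own inverse, so it may be moved to
      the other side.\<close>
    then show ?thesis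
      by (cases "even n") (auto simp: minus_equation_iff)
  qed
  \<comment> \<open>The map sending \<open>x\<close> to \<open>x / (1 - x)\<close> is a bijection
    from the complement of \<open>{0, 1}\<close> onto that of \<open>{0, -1}\<close>, with inverse
    sending \<open>y\<close> to \<open>y / (1 + y)\<close>.\<close>
  have "(\<forall>x. x \<notin> {0, 1} \<longrightarrow> x ^ n * poly h (1 / x) = poly h x) \<longleftrightarrow>
      (\<forall>y. y \<notin> {0, -1} \<longrightarrow> poly f (-1 - y) = (-1) ^ n * poly f y)" (is "_ \<longleftrightarrow> ?R")
  proof (intro iffI allI impI)
    fix y assume L: "\<forall>x. x \<notin> {0, 1} \<longrightarrow> x ^ n * poly h (1 / x) = poly h x"
      and y: "y \<notin> {0, -1::'a}"
    have "1 + y \<noteq> 0"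
      using y by (auto simp: add_eq_0_iff)
    then have "y / (1 + y) \<notin> {0, 1}" "y / (1 + y) / (1 - y / (1 + y)) = y"
      using y by (auto simp: divide_simps)
    then show "poly f (-1 - y) = (-1) ^ n * poly f y"
      using L *[of "y / (1 + y)"] by metis
  next
    fix x :: 'a assume "?R" and x: "x \<notin> {0, 1}"
    moreover have "x / (1 - x) \<notin> {0, -1}"
      using x by (auto simp: divide_simps)
    ultimately show "x ^ n * poly h (1 / x) = poly h x"
      using * by blast
  qed
  also have "\<dots> \<longleftrightarrow> (\<forall>y. y \<notin> {0, -1} \<longrightarrow>
      poly (pcompose f [:-1, -1:]) y = poly (smult ((-1) ^ n) f) y)"
    by (simp add: poly_pcompose)
  also have "\<dots> \<longleftrightarrow> pcompose f [:-1, -1:] = smult ((-1) ^ n) f"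
    using poly_eqI_cofinite[of "{0, -1}" "pcompose f [:-1, -1:]" "smult ((-1) ^ n) f"] by auto
  finally show ?thesis
    unfolding palindromic_iff[OF assms(1)] .
qed

text \<open>\<open>h_poly\<close> is characterized only by its values off the pole, so the bound is
  read off an explicit form: clearing denominators leaves summands
  \<open>x ^ i * (1 - x) ^ (n - i)\<close>, each of degree at most \<open>n\<close>.\<close>

lemma degree_h_poly: "degree (h_poly C) \<le> nat (complex_dim C + 1)"
proof -
  define n where "n = nat (complex_dim C + 1)"
  define g where "g = (\<Sum>i\<le>n. smult (coeff (f_poly C) i) ([:0, 1:] ^ i * [:1, -1:] ^ (n - i)))"
  have deg: "degree (f_poly C) \<le> n"
    unfolding f_poly_def n_def by (intro degree_sum_le) (auto intro: order.trans[OF degree_monom_le])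
  have "poly (h_poly C) x = poly g x" if "x \<notin> {1}" for x
  proof -
    have "poly (h_poly C) x = (\<Sum>i\<le>n. (1 - x) ^ n * (coeff (f_poly C) i * (x / (1 - x)) ^ i))"
      using that by (simp add: h_poly_eq poly_eq_sum_le[OF deg] sum_distrib_left flip: n_def)
    also have "\<dots> = (\<Sum>i\<le>n. coeff (f_poly C) i * (x ^ i * (1 - x) ^ (n - i)))"
      using that by (intro sum.cong) (auto simp: power_diff power_divide)
    finally show ?thesis
      by (simp add: g_def poly_sum)
  qed
  then have "h_poly C = g"
    by (intro poly_eqI_cofinite[of "{1}"]) auto
  moreover have "degree g \<le> n"
    unfolding g_def
  proof (intro degree_sum_le order.trans[OF degree_smult_le])
    fix i assume "i \<in> {..n}"
    then show "degree ([:0, 1:] ^ i * [:1, -1::real:] ^ (n - i)) \<le> n"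
      using degree_mult_le[of "[:0, 1::real:] ^ i" "[:1, -1:] ^ (n - i)"]
        degree_power_le[of "[:0, 1::real:]" i] degree_power_le[of "[:1, -1::real:]" "n - i"]
      by simp
  qed simp
  ultimately show ?thesis
    by (simp add: n_def)
qed

theorem theorem20:
  fixes C :: "'a::euclidean_space set set" and d :: int
  assumes "simplicial_complex C" and "C \<noteq> {}" and "d = complex_dim C"
  shows "(\<forall>k\<le>nat (d + 1). coeff (h_poly C) k = coeff (h_poly C) (nat (d + 1) - k)) \<longleftrightarrow>
    (\<forall>k\<in>{-1..d}.
      (\<Sum>j=k..d. (-1) powi j * real (nat (j + 1) choose nat (k + 1)) * real (f_num C j))
        = (-1) powi d * real (f_num C k))"
proof -
  define n where "n = nat (d + 1)"
  have "finite C"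
    using assms(1) by (simp add: simplicial_complex_def)
  \<comment> \<open>The maximum over a finite nonempty set is attained, hence \<open>d\<close> is at
    least \<open>-1\<close> and \<open>nat (d + 1)\<close> truncates nothing.\<close>
  then have "complex_dim C \<in> aff_dim ` C"
    unfolding complex_dim_def using assms(2) by (intro Max_in) auto
  then have "d \<ge> -1"
    using assms(3) by (auto intro: aff_dim_geq)
  then have d: "d = int n - 1"
    by (simp add: n_def)
  have n: "nat (complex_dim C + 1) = n"
    by (simp add: n_def assms(3))
  define a where "a i = real (f_num C (int i - 1))" for i
  have coeff_f: "coeff (f_poly C) i = (if i \<le> n then a i else 0)" for i
    by (simp add: f_poly_def n a_def coeff_sum)
  have deg: "degree (f_poly C) \<le> n"
    by (intro degree_le) (simp add: coeff_f)
  \<comment> \<open>Passing from dimension \<open>k\<close> to exponent \<open>k + 1\<close> costs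
    one sign. The case \<open>k = -1\<close> is separate because \<open>powi\<close> then takes an
    inverse.\<close>
  have shift: "(-1) powi k = - ((-1::real) ^ nat (k + 1))" if "k \<ge> -1" for k
    using that by (cases "k = -1") (auto simp: power_int_def nat_add_distrib)
  \<comment> \<open>Reindexing by \<open>i = j + 1\<close> produces an overall minus sign; it
    cancels against the one in \<open>(-1) powi d = - ((-1) ^ n)\<close>.\<close>
  have sums: "(\<Sum>j=int m - 1..d. (-1) powi j * real (nat (j + 1) choose nat (int m - 1 + 1)) * real (f_num C j))
      = - (\<Sum>i=m..n. (-1) ^ i * real (i choose m) * coeff (f_poly C) i)" for m
    unfolding sum_negf[symmetric]
    by (rule sum.reindex_bij_witness[of _ "\<lambda>i. int i - 1" "\<lambda>j. nat (j + 1)"])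
      (auto simp: d coeff_f a_def shift)
  have "(\<forall>k\<le>n. coeff (h_poly C) k = coeff (h_poly C) (n - k)) \<longleftrightarrow>
      (\<forall>m\<le>n. (\<Sum>i=m..n. (-1) ^ i * real (i choose m) * coeff (f_poly C) i)
        = (-1) ^ n * coeff (f_poly C) m)"
    using palindromic_iff_reflection[OF degree_h_poly[of C, unfolded n] h_poly_eq[of _ C, unfolded n]]
      pcompose_reflection_iff[OF deg] by simp
  also have "\<dots> \<longleftrightarrow> (\<forall>m\<le>n.
      (\<Sum>j=int m - 1..d. (-1) powi j * real (nat (j + 1) choose nat (int m - 1 + 1)) * real (f_num C j))
        = (-1) powi d * real (f_num C (int m - 1)))"
    unfolding sums by (simp add: d shift coeff_f a_def)
  \<comment> \<open>Only the quantifier changes: \<open>k = int m - 1\<close> runs through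
    \<open>{-1..d}\<close> as \<open>m\<close> runs through \<open>{..n}\<close>.\<close>
  also have "\<dots> \<longleftrightarrow> (\<forall>k\<in>{-1..d}.
      (\<Sum>j=k..d. (-1) powi j * real (nat (j + 1) choose nat (k + 1)) * real (f_num C j))
        = (-1) powi d * real (f_num C k))" (is "(\<forall>m\<le>n. ?P (int m - 1)) \<longleftrightarrow> _")
  proof (intro iffI ballI allI impI)
    fix k assume *: "\<forall>m\<le>n. ?P (int m - 1)" and "k \<in> {-1..d}"
    then have k: "nat (k + 1) \<le> n" "int (nat (k + 1)) - 1 = k"
      by (auto simp: d)
    show "?P k"
      using *[rule_format, OF k(1)] unfolding k(2) .
  next
    fix m assume *: "\<forall>k\<in>{-1..d}. ?P k" and "m \<le> n"
    then have "int m - 1 \<in> {-1..d}"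
      by (simp add: d)
    with * show "?P (int m - 1)"
      by (rule bspec)
  qed
  finally show ?thesis
    by (simp add: n_def)
qed

end
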